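(* Let $a,b,f_1,f_2,g_1,g_2$ be the functions given in the context and assume that $\rho_0\ne0$ is a non-spurious transverse zero of $a(\rho)$, i.e. $\rho_0$ is a non-spurious zero with $$a(\rho_0)=0,\qquad \partial_\rho a(\rho_0)\ne0.$$ Then, for $\varepsilon>0$ small enough, the system of equations $$a(\rho)+\varepsilon\left(f_1(\rho,\Omega)\cos\psi+f_2(\rho,\Omega)\sin\psi\right)=0,\qquad (b(\rho)-\Omega)\rho+\varepsilon\left(g_1(\rho,\Omega)\cos\psi-g_2(\rho,\Omega)\sin\psi\right)=0$$ in the unknowns $(\rho,\Omega,\psi)$ has an isola that perturbs from the unforced damped backbone curve $\Omega=b(\rho)$ near the amplitude value $\rho_0$.
   Context: The equations are the fixed-point equations of the reduced dynamics, in polar coordinates $s_1=\rho e^{\mathrm i\theta}$, $s_2=\bar s_1$, $\psi=\theta-\Omega t$, on a two-dimensional time-periodic spectral submanifold of a periodically forced mechanical system with forcing amplitude $\varepsilon$ and forcing frequency $\Omega$; fixed points correspond to periodic responses. The reduced dynamics, to first order in $\varepsilon$ and order $2M+1$ in $\mathbf s$, is $\dot s_1=\lambda_1s_1+\sum_{i=1}^M\gamma_is_1^{i+1}s_2^i+\varepsilon(c_{1,\mathbf 0}e^{\mathrm i\phi}+\sum_{i=1}^M(c_{1,(i,i)}(\Omega)s_1^is_2^ie^{\mathrm i\phi}+d_{1,(i+1,i-1)}(\Omega)s_1^{i+1}s_2^{i-1}e^{-\mathrm i\phi}))$, $\phi=\Omega t$, with $\mathrm{Re}\,\lambda_1<0$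 and complex coefficients $\gamma_i,c_{1,\mathbf 0}$, $c_{1,(i,i)}(\Omega),d_{1,(i+1,i-1)}(\Omega)$ (the latter depending smoothly on $\Omega$ in the frequency range considered). The functions are $a(\rho)=\mathrm{Re}(\lambda_1)\rho+\sum_{i=1}^M\mathrm{Re}(\gamma_i)\rho^{2i+1}$, $b(\rho)=\mathrm{Im}(\lambda_1)+\sum_{i=1}^M\mathrm{Im}(\gamma_i)\rho^{2i}$, $f_1=\mathrm{Re}(c_{1,\mathbf 0})+\sum_{i=1}^M(\mathrm{Re}\,c_{1,(i,i)}(\Omega)+\mathrm{Re}\,d_{1,(i+1,i-1)}(\Omega))\rho^{2i}$, $f_2=\mathrm{Im}(c_{1,\mathbf 0})+\sum_{i=1}^M(\mathrm{Im}\,c_{1,(i,i)}(\Omega)-\mathrm{Im}\,d_{1,(i+1,i-1)}(\Omega))\rho^{2i}$, $g_1=\mathrm{Im}(c_{1,\mathbf 0})+\sum_{i=1}^M(\mathrm{Im}\,c_{1,(i,i)}(\Omega)+\mathrm{Im}\,d_{1,(i+1,i-1)}(\Omega))\rho^{2i}$, $g_2=\mathrm{Re}(c_{1,\mathbf 0})+\sum_{i=1}^M(\mathrm{Re}\,c_{1,(i,i)}(\Omega)-\mathrm{Re}\,d_{1,(i+1,i-1)}(\Omega))\rho^{2i}$. A zero $\rho_0$ of $a$ (a degree-$(2M+1)$ Taylor truncation) is called non-spurious if it converges to a genuine zero of the full function $a$ (the sum of the Taylor series) as $M\to\infty$. The forced response curve (FRC) for fixed $\varepsilon$ is the projection to the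 $(\Omega,\rho)$-plane of the solution set of the equations. The main FRC is the branch perturbing from the trivial solution $\rho=0$ of the case $\varepsilon=0$. An isola is an isolated branch of solutions, i.e. a branch of the FRC detached from the main FRC. That it perturbs from the backbone curve $\Omega=b(\rho)$ near amplitude $\rho_0$ means that for small $\varepsilon>0$ it lies in a small neighborhood of $(\Omega,\rho)=(b(\rho_0),\rho_0)$, shrinking to this point as $\varepsilon\to0$. *)

theory Defs
  imports "HOL-Analysis.Analysis"
begin

text \<open>
  Throughout, \<open>lam\<close> is the eigenvalue $\lambda_1$, \<open>gam i\<close> is $\gamma_i$ (used for $i \ge 1$),
  \<open>c0\<close> is $c_{1,\mathbf 0}$, \<open>c i \<Omega>\<close> is $c_{1,(i,i)}(\Omega)$ and \<open>d i \<Omega>\<close> is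
  $d_{1,(i+1,i-1)}(\Omega)$.  The sequence \<open>gam\<close> holds the Taylor coefficients of all orders,
  of which the truncation of order $2M+1$ uses those with index at most \<open>M\<close>.
\<close>

definition a_fun :: "complex \<Rightarrow> (nat \<Rightarrow> complex) \<Rightarrow> nat \<Rightarrow> real \<Rightarrow> real" where
  "a_fun lam gam M \<rho> = Re lam * \<rho> + (\<Sum>i=1..M. Re (gam i) * \<rho> ^ (2 * i + 1))"

definition b_fun :: "complex \<Rightarrow> (nat \<Rightarrow> complex) \<Rightarrow> nat \<Rightarrow> real \<Rightarrow> real" where
  "b_fun lam gam M \<rho> = Im lam + (\<Sum>i=1..M. Im (gam i) * \<rho> ^ (2 * i))"

definition f1_fun ::
  "complex \<Rightarrow> (nat \<Rightarrow> real \<Rightarrow> complex) \<Rightarrow> (nat \<Rightarrow> real \<Rightarrow> complex) \<Rightarrow> nat \<Rightarrow> real \<Rightarrow> real \<Rightarrow> real" where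
  "f1_fun c0 c d M \<rho> \<Omega> = Re c0 + (\<Sum>i=1..M. (Re (c i \<Omega>) + Re (d i \<Omega>)) * \<rho> ^ (2 * i))"

definition f2_fun ::
  "complex \<Rightarrow> (nat \<Rightarrow> real \<Rightarrow> complex) \<Rightarrow> (nat \<Rightarrow> real \<Rightarrow> complex) \<Rightarrow> nat \<Rightarrow> real \<Rightarrow> real \<Rightarrow> real" where
  "f2_fun c0 c d M \<rho> \<Omega> = Im c0 + (\<Sum>i=1..M. (Im (c i \<Omega>) - Im (d i \<Omega>)) * \<rho> ^ (2 * i))"

definition g1_fun ::
  "complex \<Rightarrow> (nat \<Rightarrow> real \<Rightarrow> complex) \<Rightarrow> (nat \<Rightarrow> real \<Rightarrow> complex) \<Rightarrow> nat \<Rightarrow> real \<Rightarrow> real \<Rightarrow> real" where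
  "g1_fun c0 c d M \<rho> \<Omega> = Im c0 + (\<Sum>i=1..M. (Im (c i \<Omega>) + Im (d i \<Omega>)) * \<rho> ^ (2 * i))"

definition g2_fun ::
  "complex \<Rightarrow> (nat \<Rightarrow> real \<Rightarrow> complex) \<Rightarrow> (nat \<Rightarrow> real \<Rightarrow> complex) \<Rightarrow> nat \<Rightarrow> real \<Rightarrow> real \<Rightarrow> real" where
  "g2_fun c0 c d M \<rho> \<Omega> = Re c0 + (\<Sum>i=1..M. (Re (c i \<Omega>) - Re (d i \<Omega>)) * \<rho> ^ (2 * i))"

text \<open>
  $C^\infty$ on an open set: \<open>D n\<close> is the \<open>n\<close>-th derivative.
\<close>

definition smooth_fun_on :: "real set \<Rightarrow> (real \<Rightarrow> complex) \<Rightarrow> bool" where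
  "smooth_fun_on I h \<longleftrightarrow>
     (\<exists>D :: nat \<Rightarrow> real \<Rightarrow> complex. D 0 = h \<and>
        (\<forall>n. \<forall>x\<in>I. (D n has_vector_derivative D (Suc n) x) (at x)))"

text \<open>
  A genuine zero is a zero of the sum of the full Taylor series, at a point where that series
  converges; the summation index is shifted since the sum starts with $\gamma_1$.
\<close>

definition genuine_zero :: "complex \<Rightarrow> (nat \<Rightarrow> complex) \<Rightarrow> real \<Rightarrow> bool" where
  "genuine_zero lam gam \<rho> \<longleftrightarrow>
     summable (\<lambda>i. Re (gam (Suc i)) * \<rho> ^ (2 * Suc i + 1)) \<and>
     Re lam * \<rho> + (\<Sum>i. Re (gam (Suc i)) * \<rho> ^ (2 * Suc i + 1)) = 0"

text \<open>
  A zero \<open>\<rho>0\<close> of the truncation of order \<open>M\<close> is followed through the truncations of order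
  \<open>m \<ge> M\<close> as a sequence \<open>r\<close> of zeros, which has to converge to a genuine zero.  The two
  segment conditions say that \<open>r (Suc m)\<close> continues \<open>r m\<close>: the segment joining them contains
  no other zero of either truncation.  Without them \<open>r\<close> could jump to an unrelated zero
  (such as 0, a zero of every truncation), and every zero would qualify.
\<close>

definition nonspurious_zero :: "complex \<Rightarrow> (nat \<Rightarrow> complex) \<Rightarrow> nat \<Rightarrow> real \<Rightarrow> bool" where
  "nonspurious_zero lam gam M \<rho>0 \<longleftrightarrow>
     a_fun lam gam M \<rho>0 = 0 \<and>
     (\<exists>(r :: nat \<Rightarrow> real) \<rho>lim.
        r M = \<rho>0 \<and>
        (\<forall>m\<ge>M.
           {\<rho> \<in> closed_segment (r m) (r (Suc m)). a_fun lam gam m \<rho> = 0} = {r m} \<and>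
           {\<rho> \<in> closed_segment (r m) (r (Suc m)). a_fun lam gam (Suc m) \<rho> = 0} = {r (Suc m)}) \<and>
        r \<longlonglongrightarrow> \<rho>lim \<and>
        genuine_zero lam gam \<rho>lim)"

definition fixed_point_eqs ::
  "complex \<Rightarrow> (nat \<Rightarrow> complex) \<Rightarrow> complex \<Rightarrow> (nat \<Rightarrow> real \<Rightarrow> complex) \<Rightarrow> (nat \<Rightarrow> real \<Rightarrow> complex) \<Rightarrow>
   nat \<Rightarrow> real \<Rightarrow> real \<Rightarrow> real \<Rightarrow> real \<Rightarrow> bool" where
  "fixed_point_eqs lam gam c0 c d M \<epsilon> \<rho> \<Omega> \<psi> \<longleftrightarrow>
     a_fun lam gam M \<rho>
       + \<epsilon> * (f1_fun c0 c d M \<rho> \<Omega> * cos \<psi> + f2_fun c0 c d M \<rho> \<Omega> * sin \<psi>) = 0 \<and>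
     (b_fun lam gam M \<rho> - \<Omega>) * \<rho>
       + \<epsilon> * (g1_fun c0 c d M \<rho> \<Omega> * cos \<psi> - g2_fun c0 c d M \<rho> \<Omega> * sin \<psi>) = 0"

text \<open>
  The forced response curve over the frequency range \<open>I\<close>, as a set of pairs \<open>(\<Omega>, \<rho>)\<close>.
  The amplitude may be negative: the equations are invariant under
  $(\rho,\psi) \mapsto (-\rho,\psi+\pi)$, and \<open>\<rho>0\<close> is only required to be nonzero.
\<close>

definition FRC ::
  "complex \<Rightarrow> (nat \<Rightarrow> complex) \<Rightarrow> complex \<Rightarrow> (nat \<Rightarrow> real \<Rightarrow> complex) \<Rightarrow> (nat \<Rightarrow> real \<Rightarrow> complex) \<Rightarrow>
   nat \<Rightarrow> real set \<Rightarrow> real \<Rightarrow> (real \<times> real) set" where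
  "FRC lam gam c0 c d M I \<epsilon> =
     {(\<Omega>, \<rho>). \<Omega> \<in> I \<and> (\<exists>\<psi>. fixed_point_eqs lam gam c0 c d M \<epsilon> \<rho> \<Omega> \<psi>)}"

text \<open>
  Points of the FRC reached by continuing, at fixed \<open>\<Omega>\<close>, the trivial solution \<open>\<rho> = 0\<close> of the
  unforced problem from forcing amplitude 0 to \<open>\<epsilon>\<close>.
\<close>

definition trivial_continuation ::
  "complex \<Rightarrow> (nat \<Rightarrow> complex) \<Rightarrow> complex \<Rightarrow> (nat \<Rightarrow> real \<Rightarrow> complex) \<Rightarrow> (nat \<Rightarrow> real \<Rightarrow> complex) \<Rightarrow>
   nat \<Rightarrow> real set \<Rightarrow> real \<Rightarrow> (real \<times> real) set" where
  "trivial_continuation lam gam c0 c d M I \<epsilon> =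
     {(\<Omega>, \<rho>). \<exists>r. continuous_on {0..\<epsilon>} r \<and> r 0 = 0 \<and> r \<epsilon> = \<rho> \<and>
        (\<forall>e\<in>{0..\<epsilon>}. (\<Omega>, r e) \<in> FRC lam gam c0 c d M I e)}"

text \<open>
  Branches of the FRC are its connected components.  The main FRC consists of those perturbing
  from the trivial solution; with negative amplitudes admitted these come in mirror images,
  hence the union.
\<close>

definition main_FRC ::
  "complex \<Rightarrow> (nat \<Rightarrow> complex) \<Rightarrow> complex \<Rightarrow> (nat \<Rightarrow> real \<Rightarrow> complex) \<Rightarrow> (nat \<Rightarrow> real \<Rightarrow> complex) \<Rightarrow>
   nat \<Rightarrow> real set \<Rightarrow> real \<Rightarrow> (real \<times> real) set" where
  "main_FRC lam gam c0 c d M I \<epsilon> =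
     \<Union> {B \<in> components (FRC lam gam c0 c d M I \<epsilon>).
          B \<inter> trivial_continuation lam gam c0 c d M I \<epsilon> \<noteq> {}}"

text \<open>
  An isola is a branch that is isolated from the rest of the FRC and is not part of the main FRC.
\<close>

definition is_isola ::
  "complex \<Rightarrow> (nat \<Rightarrow> complex) \<Rightarrow> complex \<Rightarrow> (nat \<Rightarrow> real \<Rightarrow> complex) \<Rightarrow> (nat \<Rightarrow> real \<Rightarrow> complex) \<Rightarrow>
   nat \<Rightarrow> real set \<Rightarrow> real \<Rightarrow> (real \<times> real) set \<Rightarrow> bool" where
  "is_isola lam gam c0 c d M I \<epsilon> S \<longleftrightarrow>
     S \<in> components (FRC lam gam c0 c d M I \<epsilon>) \<and>
     (\<exists>U. open U \<and> U \<inter> FRC lam gam c0 c d M I \<epsilon> = S) \<and>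
     S \<inter> main_FRC lam gam c0 c d M I \<epsilon> = {}"

definition perturbs_from :: "(real \<Rightarrow> (real \<times> real) set) \<Rightarrow> real \<times> real \<Rightarrow> bool" where
  "perturbs_from S p \<longleftrightarrow> (\<forall>\<delta>>0. \<forall>\<^sub>F \<epsilon> in at_right 0. S \<epsilon> \<subseteq> ball p \<delta>)"

end

theory Submission
  imports Defs
begin

text \<open>
  With $w = \varepsilon e^{\mathrm i\psi}$ the equations become a family of maps of $(\Omega,\rho)$,
  affine in \<open>w\<close>, which for \<open>w = 0\<close> has the zero $(b(\rho_0),\rho_0)$ and is expanding near it, as
  $\partial_\rho a(\rho_0) \neq 0$ and $\rho_0 \neq 0$.  By an implicit function theorem the zeros near this
  point form the graph of a continuous function \<open>h\<close> of \<open>w\<close>, so that near it the FRC is the image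
  under \<open>h\<close> of the circle $|w| = \varepsilon$: a connected set that shrinks to the point and is
  both open and closed in the FRC.  A continuation from $\rho = 0$ at fixed $\Omega$ cannot end in it: by the
  intermediate value theorem it would cross an annulus that the FRC avoids for all smaller forcing
  amplitudes.
\<close>

section \<open>An implicit function theorem from Lipschitz bounds\<close>

text \<open>
  Local injectivity already yields a continuous solution, by invariance of domain applied to
  $(w,x) \mapsto (w, H(w,x))$; hence no differentiability is needed.
\<close>

lemma lipschitz_implicit_function:
  fixes H :: "'p::euclidean_space \<Rightarrow> 'a::euclidean_space \<Rightarrow> 'a"
  assumes "\<delta> > 0"
    and cont: "continuous_on (UNIV \<times> ball x0 \<delta>) (\<lambda>z. H (fst z) (snd z))"
    and low: "\<And>x y. x \<in> ball x0 \<delta> \<Longrightarrow> y \<in> ball x0 \<delta> \<Longrightarrow> norm (x - y) \<le> K * norm (H 0 x - H 0 y)"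
    and lip: "\<And>w x y. x \<in> ball x0 \<delta> \<Longrightarrow> y \<in> ball x0 \<delta> \<Longrightarrow>
        norm ((H w x - H 0 x) - (H w y - H 0 y)) \<le> L * norm w * norm (x - y)"
    and zero: "H 0 x0 = 0"
  shows "\<exists>\<eta> h. \<eta> > 0 \<and> continuous_on (ball 0 \<eta>) h \<and> h 0 = x0 \<and>
    (\<forall>w\<in>ball 0 \<eta>. {x \<in> ball x0 \<delta>. H w x = 0} = {h w})"
proof -
  \<comment> \<open>Chosen so that \<open>\<bar>K\<bar> * \<bar>L\<bar> * r < 1\<close>; the summand
    1 keeps the denominator positive even if \<open>K\<close> or \<open>L\<close> vanishes. No sign
    is assumed for either, hence the absolute values.\<close>
  define r where "r = 1 / (1 + \<bar>K\<bar> * \<bar>L\<bar>)"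
  have "r > 0" by (simp add: r_def add_pos_nonneg)
  define U where "U = ball (0::'p) r \<times> ball x0 \<delta>"
  define \<Phi> where "\<Phi> = (\<lambda>z. (fst z, H (fst z) (snd z)))"
  have inj: "x = y" if w: "norm w < r" and x: "x \<in> ball x0 \<delta>" and y: "y \<in> ball x0 \<delta>"
    and eq: "H w x = H w y" for w x y
  proof (rule ccontr)
    assume "x \<noteq> y"
    have "norm (x - y) \<le> K * norm (H 0 x - H 0 y)" by (rule low[OF x y])
    also have "\<dots> \<le> \<bar>K\<bar> * norm (H 0 x - H 0 y)"
      by (intro mult_right_mono) auto
    \<comment> \<open>Since \<open>H w\<close> agrees at \<open>x\<close> and \<open>y\<close>, the
      unperturbed increment is an increment of the perturbation alone, which is too small for
      distinct points.\<close>
    also have "norm (H 0 x - H 0 y) = norm ((H w x - H 0 x) - (H w y - H 0 y))"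
      using eq by (simp add: norm_minus_commute)
    also have "\<dots> \<le> L * norm w * norm (x - y)" by (rule lip[OF x y])
    also have "\<dots> \<le> \<bar>L\<bar> * r * norm (x - y)"
      using w \<open>r > 0\<close> by (intro mult_mono mult_nonneg_nonneg) auto
    finally have "norm (x - y) \<le> (\<bar>K\<bar> * \<bar>L\<bar> * r) * norm (x - y)"
      by (simp add: mult_left_mono mult.assoc)
    moreover have "\<bar>K\<bar> * \<bar>L\<bar> * r < 1"
    proof -
      have "0 < 1 + \<bar>K\<bar> * \<bar>L\<bar>" by (simp add: add_pos_nonneg)
      then show ?thesis by (simp add: r_def divide_less_eq)
    qed
    ultimately show False using \<open>x \<noteq> y\<close> by (simp add: mult_le_cancel_right1)
  qed
  have "inj_on \<Phi> U"
    by (rule inj_onI) (auto simp: U_def \<Phi>_def intro: inj)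
  moreover have "continuous_on U \<Phi>"
    unfolding \<Phi>_def U_def
    by (intro continuous_on_Pair continuous_on_fst continuous_on_id continuous_on_subset[OF cont]) auto
  moreover have "open U" by (simp add: U_def open_Times)
  ultimately obtain g where g: "homeomorphism U (\<Phi> ` U) \<Phi> g" and op: "open (\<Phi> ` U)"
    using invariance_of_domain_homeomorphism[of U \<Phi>] invariance_of_domain[of U \<Phi>] by auto
  have p0: "(0, x0) \<in> U" "\<Phi> (0, x0) = (0, 0)"
    using \<open>r > 0\<close> \<open>\<delta> > 0\<close> zero by (auto simp: U_def \<Phi>_def)
  then have "(0, 0) \<in> \<Phi> ` U" by (metis imageI)
  \<comment> \<open>A product neighbourhood of \<open>(0, 0)\<close> inside the open image contains
    \<open>(w, 0)\<close> for all small \<open>w\<close>, so each such \<open>w\<close> has a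
    solution in the ball. Reading off the inverse of \<open>\<Phi>\<close> there gives a continuous
    \<open>h\<close>.\<close>
  then obtain A B where AB: "open A" "open B" "0 \<in> A" "0 \<in> B" "A \<times> B \<subseteq> \<Phi> ` U"
    using op by (auto elim!: open_prod_elim)
  obtain \<eta> where \<eta>: "\<eta> > 0" "ball 0 \<eta> \<subseteq> A"
    using AB open_contains_ball by blast
  have sub: "(w, 0) \<in> \<Phi> ` U" if "w \<in> ball 0 \<eta>" for w
    using AB \<eta> that by blast
  define h where "h = (\<lambda>w. snd (g (w, 0)))"
  show ?thesis
  proof (intro exI conjI)
    show "\<eta> > 0" by fact
    show "continuous_on (ball 0 \<eta>) h"
      unfolding h_def
      by (intro continuous_on_snd continuous_on_compose2[OF homeomorphism_cont2[OF g]]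
          continuous_intros) (use sub in auto)
    show "h 0 = x0"
      using homeomorphism_apply1[OF g p0(1)] p0(2) by (simp add: h_def)
    show "\<forall>w\<in>ball 0 \<eta>. {x \<in> ball x0 \<delta>. H w x = 0} = {h w}"
    proof
      fix w assume w: "w \<in> ball (0::'p) \<eta>"
      from sub[OF w] obtain x where x: "(w, x) \<in> U" "H w x = 0"
        by (auto simp: \<Phi>_def)
      then have "h w = x"
        using homeomorphism_apply1[OF g x(1)] by (simp add: h_def \<Phi>_def)
      then show "{x \<in> ball x0 \<delta>. H w x = 0} = {h w}"
        using x inj[of w] by (auto simp: U_def)
    qed
  qed
qed

section \<open>Lipschitz and expansion estimates\<close>

lemma real_mult_lipschitz_on_compact:
  fixes f g :: "'a::metric_space \<Rightarrow> real"
  assumes "compact X" "\<exists>L. L-lipschitz_on X f" "\<exists>L. L-lipschitz_on X g"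
  shows "\<exists>L. L-lipschitz_on X (\<lambda>x. f x * g x)"
proof -
  obtain C D where C: "C-lipschitz_on X f" and D: "D-lipschitz_on X g" using assms by auto
  have "bounded (f ` X)" "bounded (g ` X)"
    using C D assms(1) lipschitz_on_continuous_on compact_continuous_image compact_imp_bounded by blast+
  then obtain A B where A: "\<And>x. x \<in> X \<Longrightarrow> \<bar>f x\<bar> \<le> A" "A > 0" and B: "\<And>x. x \<in> X \<Longrightarrow> \<bar>g x\<bar> \<le> B" "B > 0"
    unfolding bounded_pos by (metis imageI real_norm_def)
  have CD: "C \<ge> 0" "D \<ge> 0" using C D lipschitz_on_nonneg by auto
  have "(A * D + B * C)-lipschitz_on X (\<lambda>x. f x * g x)"
  proof (rule lipschitz_onI)
    show "0 \<le> A * D + B * C" using A B CD by simp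
    fix x y assume xy: "x \<in> X" "y \<in> X"
    have "dist (f x * g x) (f y * g y) = \<bar>f x * (g x - g y) + g y * (f x - f y)\<bar>"
      by (simp add: dist_real_def algebra_simps)
    also have "\<dots> \<le> \<bar>f x\<bar> * \<bar>g x - g y\<bar> + \<bar>g y\<bar> * \<bar>f x - f y\<bar>"
      by (metis abs_mult abs_triangle_ineq)
    also have "\<dots> \<le> A * (D * dist x y) + B * (C * dist x y)"
      using A B CD xy lipschitz_onD[OF C xy] lipschitz_onD[OF D xy]
      by (intro add_mono mult_mono) (auto simp: dist_real_def)
    finally show "dist (f x * g x) (f y * g y) \<le> (A * D + B * C) * dist x y"
      by (simp add: algebra_simps)
  qed
  then show ?thesis ..
qed

text \<open>The common shape of the forcing amplitudes and of \<open>b_fun\<close>: a constant plus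
  even powers of \<rho> with coefficients that may depend on \<Omega>.\<close>

lemma amplitude_series_lipschitz:
  fixes X :: "(real \<times> real) set"
  assumes "compact X" and h: "\<And>i. i \<in> {1..M} \<Longrightarrow> \<exists>L. L-lipschitz_on X (\<lambda>x. h i (fst x))"
  shows "\<exists>L. L-lipschitz_on X (\<lambda>x. k + (\<Sum>i=1..M. h i (fst x) * snd x ^ (2 * i)))"
proof -
  have snd: "1-lipschitz_on X snd"
    by (rule lipschitz_onI) (auto intro: dist_snd_le)
  have pow: "\<exists>L. L-lipschitz_on X (\<lambda>x. snd x ^ n)" for n
  proof (induction n)
    case 0
    show ?case using lipschitz_on_constant[of X 1] by auto
  next
    case (Suc n)
    then show ?case
      using real_mult_lipschitz_on_compact[OF \<open>compact X\<close> _ Suc, of snd] snd by auto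
  qed
  have "\<exists>L. L-lipschitz_on X (\<lambda>x. k + (\<Sum>i\<in>J. h i (fst x) * snd x ^ (2 * i)))"
    if "finite J" "J \<subseteq> {1..M}" for J
    using that
  proof (induction J rule: finite_induct)
    case empty
    show ?case using lipschitz_on_constant[of X k] by auto
  next
    case (insert j J)
    then obtain L1 where "L1-lipschitz_on X (\<lambda>x. k + (\<Sum>i\<in>J. h i (fst x) * snd x ^ (2 * i)))"
      by auto
    moreover obtain L2 where "L2-lipschitz_on X (\<lambda>x. h j (fst x) * snd x ^ (2 * j))"
      using real_mult_lipschitz_on_compact[OF \<open>compact X\<close> h pow] insert.prems by blast
    ultimately have "(L2 + L1)-lipschitz_on X
        (\<lambda>x. h j (fst x) * snd x ^ (2 * j) + (k + (\<Sum>i\<in>J. h i (fst x) * snd x ^ (2 * i))))"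
      by (rule lipschitz_on_add[rotated])
    then show ?case using insert.hyps by (auto simp: algebra_simps)
  qed
  then show ?thesis by blast
qed

text \<open>The derivative \<open>D 1\<close> is itself differentiable, hence continuous and bounded
  on the compact \<open>J\<close>; convexity admits the mean value inequality.\<close>

lemma smooth_fun_on_lipschitz:
  assumes "smooth_fun_on I h" "compact J" "convex J" "J \<subseteq> I"
  shows "\<exists>L. L-lipschitz_on J h"
proof -
  obtain D where D: "D 0 = h" "\<And>n x. x \<in> I \<Longrightarrow> (D n has_vector_derivative D (Suc n) x) (at x)"
    using assms(1) unfolding smooth_fun_on_def by blast
  have "continuous_on J (D 1)"
    using D(2)[of _ 1] assms(4) has_vector_derivative_continuous
    by (intro continuous_at_imp_continuous_on) blast
  then have "bounded (D 1 ` J)"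
    using assms(2) by (intro compact_imp_bounded compact_continuous_image)
  then obtain C where C: "C > 0" "\<And>x. x \<in> J \<Longrightarrow> norm (D 1 x) \<le> C"
    unfolding bounded_pos by blast
  have "C-lipschitz_on J h"
  proof (rule bounded_derivative_imp_lipschitz[where f' = "\<lambda>x t. t *\<^sub>R D 1 x"])
    show "(h has_derivative (\<lambda>t. t *\<^sub>R D 1 x)) (at x within J)" if "x \<in> J" for x
      using D(1) D(2)[of x 0] that assms(4)
      by (auto simp: has_vector_derivative_def intro: has_derivative_at_withinI)
    show "onorm (\<lambda>t. t *\<^sub>R D 1 x) \<le> C" if "x \<in> J" for x
      using C that by (intro onorm_bound) (auto simp: mult.commute[of C] intro: mult_left_mono)
  qed (use assms C in auto)
  then show ?thesis ..
qed

text \<open>By continuity the derivative keeps at least half its size near \<open>x0\<close>, and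
  the mean value theorem transfers this to increments. This is the quantitative form of
  transversality.\<close>

lemma derivative_nonzero_imp_expanding:
  fixes f :: "real \<Rightarrow> real"
  assumes der: "\<And>x. (f has_real_derivative f' x) (at x)" and "isCont f' x0" "f' x0 \<noteq> 0"
  obtains \<delta> m where "\<delta> > 0" "m > 0"
    "\<And>x y. x \<in> ball x0 \<delta> \<Longrightarrow> y \<in> ball x0 \<delta> \<Longrightarrow> m * \<bar>x - y\<bar> \<le> \<bar>f x - f y\<bar>"
proof -
  have "\<bar>f' x0\<bar> / 2 > 0" using assms by simp
  then obtain \<delta> where \<delta>: "\<delta> > 0" "\<And>x. dist x x0 < \<delta> \<Longrightarrow> dist (f' x) (f' x0) < \<bar>f' x0\<bar> / 2"
    using assms(2) unfolding continuous_at_eps_delta by metis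
  have big: "\<bar>f' x\<bar> \<ge> \<bar>f' x0\<bar> / 2" if "x \<in> ball x0 \<delta>" for x
    using \<delta>(2)[of x] that abs_triangle_ineq2[of "f' x0" "f' x"]
    by (auto simp: dist_real_def abs_minus_commute)
  have *: "\<bar>f' x0\<bar> / 2 * \<bar>x - y\<bar> \<le> \<bar>f x - f y\<bar>"
    if "x \<in> ball x0 \<delta>" "y \<in> ball x0 \<delta>" "x < y" for x y
  proof -
    obtain z where z: "x < z" "z < y" "f y - f x = (y - x) * f' z"
      using MVT2[OF \<open>x < y\<close>, of f f'] der by blast
    then have "z \<in> ball x0 \<delta>" using that by (auto simp: dist_real_def)
    then have "\<bar>f' x0\<bar> / 2 * \<bar>y - x\<bar> \<le> \<bar>f' z\<bar> * \<bar>y - x\<bar>" by (intro mult_right_mono big) auto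
    also have "\<dots> = \<bar>f y - f x\<bar>" using z by (simp add: abs_mult mult.commute)
    finally show ?thesis by (simp add: abs_minus_commute)
  qed
  show thesis
  proof
    show "\<delta> > 0" "\<bar>f' x0\<bar> / 2 > 0" by fact+
    show "\<bar>f' x0\<bar> / 2 * \<bar>x - y\<bar> \<le> \<bar>f x - f y\<bar>" if "x \<in> ball x0 \<delta>" "y \<in> ball x0 \<delta>" for x y
      using *[of x y] *[of y x] that by (cases x y rule: linorder_cases) (auto simp: abs_minus_commute)
  qed
qed

section \<open>Isolating a branch and separating it from the main FRC\<close>

text \<open>Inside a connected \<open>D\<close> with \<open>C \<subseteq> D \<subseteq> X\<close>,
  the set \<open>C\<close> is nonempty and clopen, so it is all of \<open>D\<close>; this is
  maximality.\<close>

lemma clopen_connected_in_components: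
  assumes "connected C" "C \<noteq> {}" "openin (top_of_set X) C" "closedin (top_of_set X) C"
  shows "C \<in> components X"
proof -
  have "C \<subseteq> X" using assms(3) openin_imp_subset by blast
  moreover have "D = C" if D: "D \<noteq> {}" "D \<subseteq> X" "C \<subseteq> D" "connected D" for D
  proof -
    have "openin (top_of_set D) C" "closedin (top_of_set D) C"
      using assms D openin_subset_trans closedin_subset_trans by blast+
    then show ?thesis using D(4) assms(2) connected_clopen by blast
  qed
  ultimately show ?thesis
    using assms unfolding in_components_maximal by blast
qed

text \<open>For every forcing amplitude in \<open>{0<..\<epsilon>}\<close> the FRC misses the
  annulus between radii \<open>\<delta> / 2\<close> and \<open>\<delta>\<close>. At
  \<open>\<epsilon>\<close> itself this detaches the inner piece; at smaller amplitudes it blocks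
  continuations from zero, because \<open>\<delta> \<le> \<bar>\<rho>0\<bar>\<close> puts every
  \<open>(\<Omega>, 0)\<close> outside the open ball.\<close>

lemma is_isola_confined:
  assumes "\<epsilon> > 0" "0 < \<delta>" "\<delta> \<le> \<bar>\<rho>0\<bar>"
    and confined: "\<And>e. 0 < e \<Longrightarrow> e \<le> \<epsilon> \<Longrightarrow>
      FRC lam gam c0 c d M I e \<inter> ball (\<Omega>0, \<rho>0) \<delta> \<subseteq> cball (\<Omega>0, \<rho>0) (\<delta> / 2)"
    and "connected (FRC lam gam c0 c d M I \<epsilon> \<inter> ball (\<Omega>0, \<rho>0) \<delta>)"
    and "FRC lam gam c0 c d M I \<epsilon> \<inter> ball (\<Omega>0, \<rho>0) \<delta> \<noteq> {}"
  shows "is_isola lam gam c0 c d M I \<epsilon> (FRC lam gam c0 c d M I \<epsilon> \<inter> ball (\<Omega>0, \<rho>0) \<delta>)"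
    (is "is_isola _ _ _ _ _ _ _ _ ?S")
proof -
  let ?F = "FRC lam gam c0 c d M I"
  \<comment> \<open>Cutting with the open ball and with the smaller closed ball gives the same set,
    which is therefore both open and closed in the FRC.\<close>
  have "?S = ?F \<epsilon> \<inter> cball (\<Omega>0, \<rho>0) (\<delta> / 2)"
    using confined[of \<epsilon>] \<open>\<epsilon> > 0\<close> \<open>0 < \<delta>\<close> by (auto simp: dist_commute)
  then have "closedin (top_of_set (?F \<epsilon>)) ?S"
    by (simp add: closedin_closed_Int)
  then have comp: "?S \<in> components (?F \<epsilon>)"
    using assms by (intro clopen_connected_in_components) (auto simp: openin_open_Int)
  have "?S \<inter> trivial_continuation lam gam c0 c d M I \<epsilon> = {}"
  proof (rule ccontr)
    assume "?S \<inter> trivial_continuation lam gam c0 c d M I \<epsilon> \<noteq> {}"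
    then obtain \<Omega> r where r: "continuous_on {0..\<epsilon>} r" "r 0 = 0" "(\<Omega>, r \<epsilon>) \<in> ?S"
      "\<And>e. e \<in> {0..\<epsilon>} \<Longrightarrow> (\<Omega>, r e) \<in> ?F e"
      unfolding trivial_continuation_def by fastforce
    let ?D = "\<lambda>e. dist (\<Omega>0, \<rho>0) (\<Omega>, r e)"
    have "(\<Omega>, r \<epsilon>) \<in> cball (\<Omega>0, \<rho>0) (\<delta> / 2)" using confined[of \<epsilon>] r(3) \<open>\<epsilon> > 0\<close> by auto
    \<comment> \<open>The level \<open>3 * \<delta> / 4\<close> lies strictly inside the forbidden
      annulus; the path starts beyond it and ends below it.\<close>
    then have 1: "?D \<epsilon> \<le> 3 * \<delta> / 4" using \<open>0 < \<delta>\<close> by simp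
    have "dist \<rho>0 (r 0) \<le> ?D 0" using dist_snd_le[of "(\<Omega>0, \<rho>0)" "(\<Omega>, r 0)"] by simp
    then have 2: "\<delta> \<le> ?D 0" using r(2) \<open>\<delta> \<le> \<bar>\<rho>0\<bar>\<close> by (simp add: dist_real_def)
    have "continuous_on {0..\<epsilon>} ?D" using r(1) by (intro continuous_intros)
    then obtain e where e: "0 \<le> e" "e \<le> \<epsilon>" "?D e = 3 * \<delta> / 4"
      using IVT2'[of ?D \<epsilon> "3 * \<delta> / 4" 0] 1 2 \<open>\<epsilon> > 0\<close> \<open>0 < \<delta>\<close> by auto
    \<comment> \<open>Confinement is assumed for positive forcing only, so the crossing must not
      occur at \<open>e = 0\<close>.\<close>
    then have "e \<noteq> 0" using 2 \<open>0 < \<delta>\<close> by auto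
    moreover have "(\<Omega>, r e) \<in> ?F e \<inter> ball (\<Omega>0, \<rho>0) \<delta>"
      using e r(4) \<open>0 < \<delta>\<close> by auto
    ultimately have "(\<Omega>, r e) \<in> cball (\<Omega>0, \<rho>0) (\<delta> / 2)"
      using confined[of e] e by auto
    then show False using e \<open>0 < \<delta>\<close> by simp
  qed
  \<comment> \<open>Components that meet coincide. If \<open>?S\<close> met the main FRC, it would
    be one of its branches and so contain a trivial continuation point.\<close>
  then have "?S \<inter> main_FRC lam gam c0 c d M I \<epsilon> = {}"
    using components_nonoverlap[OF comp] unfolding main_FRC_def by blast
  then show ?thesis
    using comp unfolding is_isola_def by (auto intro!: exI[of _ "ball (\<Omega>0, \<rho>0) \<delta>"])
qed

section \<open>Lipschitz bounds for the forcing amplitudes\<close>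

lemma lipschitz_on_compose_fst:
  assumes "L-lipschitz_on J h" "fst ` X \<subseteq> J"
  shows "L-lipschitz_on X (\<lambda>x. h (fst x))"
proof (rule lipschitz_onI)
  show L: "0 \<le> L" using assms(1) by (rule lipschitz_on_nonneg)
  fix x y assume "x \<in> X" "y \<in> X"
  then have "dist (h (fst x)) (h (fst y)) \<le> L * dist (fst x) (fst y)"
    using assms by (intro lipschitz_onD[OF assms(1)]) auto
  also have "\<dots> \<le> L * dist x y" using L by (intro mult_left_mono dist_fst_le)
  finally show "dist (h (fst x)) (h (fst y)) \<le> L * dist x y" .
qed

lemma lipschitz_on_Re_Im:
  assumes "L-lipschitz_on X h"
  shows "L-lipschitz_on X (\<lambda>x. Re (h x))" "L-lipschitz_on X (\<lambda>x. Im (h x))"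
  using assms abs_Re_le_cmod abs_Im_le_cmod
  unfolding lipschitz_on_def dist_norm real_norm_def
  by (metis minus_complex.simps(1) order_trans, metis minus_complex.simps(2) order_trans)

text \<open>Smooth coefficients are Lipschitz on a compact interval \<open>J\<close> of frequencies
  inside \<open>I\<close>, so the points of \<open>X\<close> must have their frequencies
  there.\<close>

lemma forcing_amplitudes_lipschitz:
  fixes X :: "(real \<times> real) set"
  assumes "compact X" "fst ` X \<subseteq> J" "compact J" "convex J" "J \<subseteq> I"
    and c: "\<And>i. i \<in> {1..M} \<Longrightarrow> smooth_fun_on I (c i)"
    and d: "\<And>i. i \<in> {1..M} \<Longrightarrow> smooth_fun_on I (d i)"
  shows "\<exists>L. L-lipschitz_on X (\<lambda>x. f1_fun c0 c d M (snd x) (fst x))"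
    and "\<exists>L. L-lipschitz_on X (\<lambda>x. f2_fun c0 c d M (snd x) (fst x))"
    and "\<exists>L. L-lipschitz_on X (\<lambda>x. g1_fun c0 c d M (snd x) (fst x))"
    and "\<exists>L. L-lipschitz_on X (\<lambda>x. g2_fun c0 c d M (snd x) (fst x))"
proof -
  have c': "\<exists>L. L-lipschitz_on X (\<lambda>x. c i (fst x))" if "i \<in> {1..M}" for i
    using smooth_fun_on_lipschitz[OF c[OF that]] lipschitz_on_compose_fst assms by metis
  have d': "\<exists>L. L-lipschitz_on X (\<lambda>x. d i (fst x))" if "i \<in> {1..M}" for i
    using smooth_fun_on_lipschitz[OF d[OF that]] lipschitz_on_compose_fst assms by metis
  note series = amplitude_series_lipschitz[OF \<open>compact X\<close>]
  show "\<exists>L. L-lipschitz_on X (\<lambda>x. f1_fun c0 c d M (snd x) (fst x))"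
    unfolding f1_fun_def
    by (rule series) (metis c' d' lipschitz_on_add lipschitz_on_diff lipschitz_on_Re_Im)
  show "\<exists>L. L-lipschitz_on X (\<lambda>x. f2_fun c0 c d M (snd x) (fst x))"
    unfolding f2_fun_def
    by (rule series) (metis c' d' lipschitz_on_add lipschitz_on_diff lipschitz_on_Re_Im)
  show "\<exists>L. L-lipschitz_on X (\<lambda>x. g1_fun c0 c d M (snd x) (fst x))"
    unfolding g1_fun_def
    by (rule series) (metis c' d' lipschitz_on_add lipschitz_on_diff lipschitz_on_Re_Im)
  show "\<exists>L. L-lipschitz_on X (\<lambda>x. g2_fun c0 c d M (snd x) (fst x))"
    unfolding g2_fun_def
    by (rule series) (metis c' d' lipschitz_on_add lipschitz_on_diff lipschitz_on_Re_Im)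
qed

section \<open>The fixed-point map and its estimates\<close>

text \<open>Here \<open>Re w\<close> stands for \<open>\<epsilon> * cos \<psi>\<close> and
  \<open>Im w\<close> for \<open>\<epsilon> * sin \<psi>\<close>. This removes the degeneracy at
  \<open>\<epsilon> = 0\<close>, where the phase is undetermined.\<close>

definition fp_map ::
  "complex \<Rightarrow> (nat \<Rightarrow> complex) \<Rightarrow> complex \<Rightarrow> (nat \<Rightarrow> real \<Rightarrow> complex) \<Rightarrow> (nat \<Rightarrow> real \<Rightarrow> complex) \<Rightarrow>
   nat \<Rightarrow> complex \<Rightarrow> real \<times> real \<Rightarrow> real \<times> real" where
  "fp_map lam gam c0 c d M w x =
     (a_fun lam gam M (snd x)
        + (Re w * f1_fun c0 c d M (snd x) (fst x) + Im w * f2_fun c0 c d M (snd x) (fst x)),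
      (b_fun lam gam M (snd x) - fst x) * snd x
        + (Re w * g1_fun c0 c d M (snd x) (fst x) - Im w * g2_fun c0 c d M (snd x) (fst x)))"

lemma fixed_point_eqs_iff_fp_map:
  "fixed_point_eqs lam gam c0 c d M \<epsilon> \<rho> \<Omega> \<psi> \<longleftrightarrow> fp_map lam gam c0 c d M (rcis \<epsilon> \<psi>) (\<Omega>, \<rho>) = 0"
  by (simp add: fixed_point_eqs_def fp_map_def zero_prod_def algebra_simps)

text \<open>Subtracting the map at \<open>w = 0\<close> leaves only the forcing terms, linear in
  \<open>w\<close> with Lipschitz factors. This provides the perturbation bound of the implicit
  function theorem.\<close>

lemma fp_map_perturbation_lipschitz:
  fixes X :: "(real \<times> real) set"
  assumes "\<exists>L. L-lipschitz_on X (\<lambda>x. f1_fun c0 c d M (snd x) (fst x))"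
    and "\<exists>L. L-lipschitz_on X (\<lambda>x. f2_fun c0 c d M (snd x) (fst x))"
    and "\<exists>L. L-lipschitz_on X (\<lambda>x. g1_fun c0 c d M (snd x) (fst x))"
    and "\<exists>L. L-lipschitz_on X (\<lambda>x. g2_fun c0 c d M (snd x) (fst x))"
  obtains L where "\<And>(w::complex) x y. x \<in> X \<Longrightarrow> y \<in> X \<Longrightarrow>
     norm ((fp_map lam gam c0 c d M w x - fp_map lam gam c0 c d M 0 x)
         - (fp_map lam gam c0 c d M w y - fp_map lam gam c0 c d M 0 y)) \<le> L * norm w * norm (x - y)"
proof -
  let ?f1 = "\<lambda>x. f1_fun c0 c d M (snd x) (fst x)" and ?f2 = "\<lambda>x. f2_fun c0 c d M (snd x) (fst x)"
  let ?g1 = "\<lambda>x. g1_fun c0 c d M (snd x) (fst x)" and ?g2 = "\<lambda>x. g2_fun c0 c d M (snd x) (fst x)"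
  let ?H = "fp_map lam gam c0 c d M"
  obtain L1 L2 L3 L4 where L: "L1-lipschitz_on X ?f1" "L2-lipschitz_on X ?f2"
      "L3-lipschitz_on X ?g1" "L4-lipschitz_on X ?g2"
    using assms by blast
  show thesis
  proof
    fix w :: complex and x y assume xy: "x \<in> X" "y \<in> X"
    have term_le: "\<bar>s * (k x - k y)\<bar> \<le> norm w * (l * norm (x - y))"
      if "\<bar>s\<bar> \<le> norm w" "l-lipschitz_on X k" for s l and k :: "real \<times> real \<Rightarrow> real"
      using lipschitz_on_normD[OF that(2) xy] that(1) by (auto simp: abs_mult intro!: mult_mono)
    have "norm ((?H w x - ?H 0 x) - (?H w y - ?H 0 y))
        = norm (Re w * (?f1 x - ?f1 y) + Im w * (?f2 x - ?f2 y),
                Re w * (?g1 x - ?g1 y) - Im w * (?g2 x - ?g2 y))"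
      by (simp add: fp_map_def algebra_simps)
    also have "\<dots> \<le> \<bar>Re w * (?f1 x - ?f1 y) + Im w * (?f2 x - ?f2 y)\<bar>
        + \<bar>Re w * (?g1 x - ?g1 y) - Im w * (?g2 x - ?g2 y)\<bar>"
      by (rule order_trans[OF norm_Pair_le]) simp
    also have "\<dots> \<le> (\<bar>Re w * (?f1 x - ?f1 y)\<bar> + \<bar>Im w * (?f2 x - ?f2 y)\<bar>)
        + (\<bar>Re w * (?g1 x - ?g1 y)\<bar> + \<bar>Im w * (?g2 x - ?g2 y)\<bar>)"
      by (intro add_mono abs_triangle_ineq abs_triangle_ineq4)
    also have "\<dots> \<le> (norm w * (L1 * norm (x - y)) + norm w * (L2 * norm (x - y)))
        + (norm w * (L3 * norm (x - y)) + norm w * (L4 * norm (x - y)))"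
      by (intro add_mono term_le abs_Re_le_cmod abs_Im_le_cmod L)
    finally show "norm ((?H w x - ?H 0 x) - (?H w y - ?H 0 y))
        \<le> (L1 + L2 + L3 + L4) * norm w * norm (x - y)"
      by (simp add: algebra_simps)
  qed
qed

lemma b_fun_times_lipschitz:
  fixes X :: "(real \<times> real) set"
  assumes "compact X"
  shows "\<exists>L. L-lipschitz_on X (\<lambda>x. b_fun lam gam M (snd x) * snd x)"
proof (rule real_mult_lipschitz_on_compact[OF assms])
  show "\<exists>L. L-lipschitz_on X (\<lambda>x. b_fun lam gam M (snd x))"
    unfolding b_fun_def using lipschitz_on_constant
    by (intro amplitude_series_lipschitz[OF assms]) blast
  have "1-lipschitz_on X snd" by (rule lipschitz_onI) (auto intro: dist_snd_le)
  then show "\<exists>L. L-lipschitz_on X snd" ..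
qed

text \<open>The unforced map is triangular: its first component depends on \<rho> alone and controls
  it. In the second, \<Omega> is multiplied by \<rho>, which stays away from zero, so \<Omega> is
  controlled next.\<close>

lemma fp_map_unforced_expanding:
  assumes "m > 0" "0 < \<delta>" "\<delta> \<le> \<bar>\<rho>0\<bar> / 2"
    and a: "\<And>\<rho> \<rho>'. \<rho> \<in> ball \<rho>0 \<delta> \<Longrightarrow> \<rho>' \<in> ball \<rho>0 \<delta> \<Longrightarrow>
      m * \<bar>\<rho> - \<rho>'\<bar> \<le> \<bar>a_fun lam gam M \<rho> - a_fun lam gam M \<rho>'\<bar>"
  obtains K where "\<And>x y. x \<in> ball (\<Omega>0, \<rho>0) \<delta> \<Longrightarrow> y \<in> ball (\<Omega>0, \<rho>0) \<delta> \<Longrightarrow>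
     norm (x - y) \<le> K * norm (fp_map lam gam c0 c d M 0 x - fp_map lam gam c0 c d M 0 y)"
proof -
  let ?H = "fp_map lam gam c0 c d M 0"
  let ?q = "\<lambda>\<rho>. b_fun lam gam M \<rho> * \<rho>"
  obtain L where L: "L-lipschitz_on (cball (\<Omega>0, \<rho>0) \<delta>) (\<lambda>x. ?q (snd x))"
    using b_fun_times_lipschitz[OF compact_cball] by blast
  have "L \<ge> 0" using L by (rule lipschitz_on_nonneg)
  \<comment> \<open>On the ball, \<open>C\<close> bounds the frequency from above and
    \<open>r\<close> bounds the modulus of the amplitude from below.\<close>
  define C where "C = \<bar>\<Omega>0\<bar> + \<delta>"
  define r where "r = \<bar>\<rho>0\<bar> / 2"
  have r: "r > 0" using assms(2,3) by (simp add: r_def)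
  show thesis
  proof
    fix x y assume x: "x \<in> ball (\<Omega>0, \<rho>0) \<delta>" and y: "y \<in> ball (\<Omega>0, \<rho>0) \<delta>"
    obtain \<Omega> \<rho> \<Omega>' \<rho>' where xy: "x = (\<Omega>, \<rho>)" "y = (\<Omega>', \<rho>')" by (cases x, cases y)
    have \<rho>: "\<rho> \<in> ball \<rho>0 \<delta>" "\<rho>' \<in> ball \<rho>0 \<delta>" and \<Omega>': "\<Omega>' \<in> ball \<Omega>0 \<delta>"
      using x y dist_snd_le[of "(\<Omega>0, \<rho>0)" x] dist_snd_le[of "(\<Omega>0, \<rho>0)" y]
        dist_fst_le[of "(\<Omega>0, \<rho>0)" y]
      unfolding xy mem_ball fst_conv snd_conv by linarith+
    define E where "E = norm (?H x - ?H y)"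
    define \<Delta> where "\<Delta> = (b_fun lam gam M \<rho> - \<Omega>) * \<rho> - (b_fun lam gam M \<rho>' - \<Omega>') * \<rho>'"
    have diff: "?H x - ?H y = (a_fun lam gam M \<rho> - a_fun lam gam M \<rho>', \<Delta>)"
      by (simp add: fp_map_def xy \<Delta>_def)
    have "\<bar>a_fun lam gam M \<rho> - a_fun lam gam M \<rho>'\<bar> \<le> E" and \<Delta>: "\<bar>\<Delta>\<bar> \<le> E"
      using norm_fst_le[of "a_fun lam gam M \<rho> - a_fun lam gam M \<rho>'" \<Delta>]
        norm_snd_le[of \<Delta> "a_fun lam gam M \<rho> - a_fun lam gam M \<rho>'"]
      unfolding E_def diff real_norm_def .
    with a[OF \<rho>] have "m * \<bar>\<rho> - \<rho>'\<bar> \<le> E" by linarith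
    then have \<rho>_le: "\<bar>\<rho> - \<rho>'\<bar> \<le> E / m" using \<open>m > 0\<close> by (simp add: field_simps)
    have "\<bar>?q \<rho> - ?q \<rho>'\<bar> \<le> L * \<bar>\<rho> - \<rho>'\<bar>"
      using lipschitz_onD[OF L, of "(\<Omega>0, \<rho>)" "(\<Omega>0, \<rho>')"] \<rho>
      by (auto simp: dist_Pair_Pair dist_real_def)
    moreover have "\<bar>\<Omega>' * (\<rho> - \<rho>')\<bar> \<le> C * \<bar>\<rho> - \<rho>'\<bar>"
      using \<Omega>' unfolding abs_mult by (intro mult_right_mono) (auto simp: C_def dist_real_def)
    \<comment> \<open>Solving the second component for the frequency increment leaves terms bounded
      by the amplitude increment and by \<open>\<Delta>\<close>.\<close>
    moreover have "\<rho> * (\<Omega> - \<Omega>') = (?q \<rho> - ?q \<rho>') - \<Omega>' * (\<rho> - \<rho>') - \<Delta>"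
      by (simp add: \<Delta>_def algebra_simps)
    ultimately have "\<bar>\<rho> * (\<Omega> - \<Omega>')\<bar> \<le> (L + C) * \<bar>\<rho> - \<rho>'\<bar> + E"
      using \<Delta> unfolding distrib_right by linarith
    also have "\<dots> \<le> (L + C) * (E / m) + E"
      using \<rho>_le \<open>L \<ge> 0\<close> \<open>0 < \<delta>\<close> by (intro add_mono mult_left_mono) (auto simp: C_def)
    finally have "\<bar>\<rho> * (\<Omega> - \<Omega>')\<bar> \<le> ((L + C) / m + 1) * E" by (simp add: algebra_simps)
    moreover have "r \<le> \<bar>\<rho>\<bar>"
      using \<rho>(1) assms(3) by (auto simp: r_def dist_real_def)
    then have "r * \<bar>\<Omega> - \<Omega>'\<bar> \<le> \<bar>\<rho> * (\<Omega> - \<Omega>')\<bar>"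
      unfolding abs_mult by (intro mult_right_mono) auto
    ultimately have "\<bar>\<Omega> - \<Omega>'\<bar> \<le> ((L + C) / m + 1) * E / r"
      using r by (simp add: pos_le_divide_eq mult.commute)
    then have "norm (x - y) \<le> ((L + C) / m + 1) * E / r + E / m"
      using \<rho>_le norm_Pair_le[of "\<Omega> - \<Omega>'" "\<rho> - \<rho>'"] by (simp add: xy)
    then show "norm (x - y) \<le> (((L + C) / m + 1) / r + 1 / m) * norm (?H x - ?H y)"
      by (simp add: E_def algebra_simps)
  qed
qed

lemma a_fun_expanding:
  assumes "deriv (a_fun lam gam M) \<rho>0 \<noteq> 0"
  obtains \<delta> m where "\<delta> > 0" "m > 0"
    "\<And>x y. x \<in> ball \<rho>0 \<delta> \<Longrightarrow> y \<in> ball \<rho>0 \<delta> \<Longrightarrow>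
       m * \<bar>x - y\<bar> \<le> \<bar>a_fun lam gam M x - a_fun lam gam M y\<bar>"
proof -
  define a' where "a' = (\<lambda>\<rho>. Re lam + (\<Sum>i=1..M. Re (gam i) * (real (2 * i + 1) * \<rho> ^ (2 * i))))"
  have der: "(a_fun lam gam M has_real_derivative a' \<rho>) (at \<rho>)" for \<rho>
    unfolding a_fun_def a'_def
    by (rule derivative_eq_intros refl sum.cong | simp)+
  moreover have "isCont a' \<rho>0"
    unfolding a'_def by (intro continuous_intros)
  moreover have "a' \<rho>0 \<noteq> 0"
    using assms DERIV_imp_deriv[OF der] by simp
  ultimately show thesis
    using that by (rule derivative_nonzero_imp_expanding)
qed

section \<open>The isola as the image of a small circle\<close>

theorem theorem4:
  fixes lam c0 :: complex
    and gam :: "nat \<Rightarrow> complex"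
    and c d :: "nat \<Rightarrow> real \<Rightarrow> complex"
    and M :: nat
    and I :: "real set"
    and \<rho>0 :: real
  assumes "Re lam < 0"
    and "open I"
    and "\<And>i. i \<in> {1..M} \<Longrightarrow> smooth_fun_on I (c i)"
    and "\<And>i. i \<in> {1..M} \<Longrightarrow> smooth_fun_on I (d i)"
    and "\<rho>0 \<noteq> 0"
    and "nonspurious_zero lam gam M \<rho>0"
    and "deriv (a_fun lam gam M) \<rho>0 \<noteq> 0"
    and "b_fun lam gam M \<rho>0 \<in> I"
  shows "\<exists>S :: real \<Rightarrow> (real \<times> real) set.
           (\<forall>\<^sub>F \<epsilon> in at_right 0. is_isola lam gam c0 c d M I \<epsilon> (S \<epsilon>)) \<and>
           perturbs_from S (b_fun lam gam M \<rho>0, \<rho>0)"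
proof -
  define \<Omega>0 where "\<Omega>0 = b_fun lam gam M \<rho>0"
  let ?H = "fp_map lam gam c0 c d M"
  let ?F = "FRC lam gam c0 c d M I"
  let ?p0 = "(\<Omega>0, \<rho>0)"
  obtain \<delta>1 where \<delta>1: "\<delta>1 > 0" "cball \<Omega>0 \<delta>1 \<subseteq> I"
    using assms(2,8) open_contains_cball unfolding \<Omega>0_def by blast
  obtain \<delta>2 m where \<delta>2: "\<delta>2 > 0" "m > 0"
    "\<And>x y. x \<in> ball \<rho>0 \<delta>2 \<Longrightarrow> y \<in> ball \<rho>0 \<delta>2 \<Longrightarrow>
       m * \<bar>x - y\<bar> \<le> \<bar>a_fun lam gam M x - a_fun lam gam M y\<bar>"
    using a_fun_expanding[OF assms(7)] by metis
  \<comment> \<open>The three bounds keep frequencies in \<open>I\<close>, preserve the expansion of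
    \<open>a_fun\<close>, and keep amplitudes away from zero.\<close>
  define \<delta> where "\<delta> = min (min \<delta>1 \<delta>2) (\<bar>\<rho>0\<bar> / 2)"
  have \<delta>: "\<delta> > 0" "\<delta> \<le> \<delta>1" "\<delta> \<le> \<delta>2" "\<delta> \<le> \<bar>\<rho>0\<bar> / 2"
    using \<delta>1 \<delta>2 assms(5) by (auto simp: \<delta>_def)
  have fst_I: "fst ` cball ?p0 \<delta> \<subseteq> cball \<Omega>0 \<delta>1"
    using \<delta>(2) dist_fst_le[of ?p0] by (fastforce intro: order_trans)
  note lip = forcing_amplitudes_lipschitz[where ?c0.0 = c0 and c = c and d = d and M = M, OF compact_cball fst_I compact_cball convex_cball \<delta>1(2) assms(3,4)]
  obtain L where L: "\<And>w x y. x \<in> cball ?p0 \<delta> \<Longrightarrow> y \<in> cball ?p0 \<delta> \<Longrightarrow>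
     norm ((?H w x - ?H 0 x) - (?H w y - ?H 0 y)) \<le> L * norm w * norm (x - y)"
    using fp_map_perturbation_lipschitz[OF lip] by metis
  have "m * \<bar>x - y\<bar> \<le> \<bar>a_fun lam gam M x - a_fun lam gam M y\<bar>"
    if "x \<in> ball \<rho>0 \<delta>" "y \<in> ball \<rho>0 \<delta>" for x y
    using \<delta>2(3) that \<delta>(3) by auto
  then obtain K where K: "\<And>x y. x \<in> ball ?p0 \<delta> \<Longrightarrow> y \<in> ball ?p0 \<delta> \<Longrightarrow>
     norm (x - y) \<le> K * norm (?H 0 x - ?H 0 y)"
    using fp_map_unforced_expanding[OF \<delta>2(2) \<delta>(1,4)] by metis
  have cont: "continuous_on (UNIV \<times> ball ?p0 \<delta>) (\<lambda>z. ?H (fst z) (snd z))"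
  proof -
    \<comment> \<open>The Lipschitz bounds on the closed ball also yield continuity of the four
      forcing amplitudes; the other terms are polynomial.\<close>
    have *: "continuous_on (UNIV \<times> ball ?p0 \<delta>) (\<lambda>z. k (snd z))"
      if "\<exists>L. L-lipschitz_on (cball ?p0 \<delta>) k" for k :: "real \<times> real \<Rightarrow> real"
    proof -
      from that have "continuous_on (cball ?p0 \<delta>) k" using lipschitz_on_continuous_on by blast
      then show ?thesis by (rule continuous_on_compose2) (auto intro: continuous_on_snd continuous_on_id)
    qed
    show ?thesis
      unfolding fp_map_def a_fun_def b_fun_def
      by (intro continuous_intros lip[THEN *])
  qed
  have zero: "?H 0 ?p0 = 0"
    using assms(6) by (simp add: fp_map_def nonspurious_zero_def \<Omega>0_def zero_prod_def)
  have L': "norm ((?H w x - ?H 0 x) - (?H w y - ?H 0 y)) \<le> L * norm w * norm (x - y)"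
    if "x \<in> ball ?p0 \<delta>" "y \<in> ball ?p0 \<delta>" for w x y
    using that ball_subset_cball by (intro L) blast+
  have "\<exists>\<eta> h. \<eta> > 0 \<and> continuous_on (ball 0 \<eta>) h \<and> h 0 = ?p0 \<and>
      (\<forall>w\<in>ball 0 \<eta>. {x \<in> ball ?p0 \<delta>. ?H w x = 0} = {h w})"
    by (rule lipschitz_implicit_function[OF \<delta>(1) cont K L' zero])
  then obtain \<eta> h where \<eta>: "\<eta> > 0" and h: "continuous_on (ball 0 \<eta>) h" "h 0 = ?p0"
    "\<forall>w\<in>ball 0 \<eta>. {x \<in> ball ?p0 \<delta>. ?H w x = 0} = {h w}"
    by (elim exE conjE) (rule that)
  define S where "S = (\<lambda>\<epsilon>. ?F \<epsilon> \<inter> ball ?p0 \<delta>)"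
  have S: "S \<epsilon> = range (\<lambda>\<psi>. h (rcis \<epsilon> \<psi>))" if "0 < \<epsilon>" "\<epsilon> < \<eta>" for \<epsilon>
  proof -
    have "S \<epsilon> = {x \<in> ball ?p0 \<delta>. \<exists>\<psi>. ?H (rcis \<epsilon> \<psi>) x = 0}"
    proof -
      \<comment> \<open>The restriction to \<open>I\<close> in the FRC holds automatically on the
        ball, so only the equation remains.\<close>
      have "fst x \<in> I" if "x \<in> ball ?p0 \<delta>" for x
        using fst_I \<delta>1(2) that ball_subset_cball by blast
      then show ?thesis
        by (auto simp: S_def FRC_def fixed_point_eqs_iff_fp_map simp del: mem_ball)
    qed
    also have "\<dots> = (\<Union>\<psi>. {x \<in> ball ?p0 \<delta>. ?H (rcis \<epsilon> \<psi>) x = 0})" by auto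
    also have "\<dots> = range (\<lambda>\<psi>. h (rcis \<epsilon> \<psi>))"
      using h(3) that by auto
    finally show ?thesis .
  qed
  \<comment> \<open>Continuity of \<open>h\<close> at 0 makes the images of small circles shrink to
    \<open>?p0\<close>. This serves twice: for confinement and for the perturbation claim.\<close>
  have small: "\<exists>\<eta>'>0. \<eta>' \<le> \<eta> \<and> (\<forall>\<epsilon>. 0 < \<epsilon> \<and> \<epsilon> < \<eta>' \<longrightarrow> S \<epsilon> \<subseteq> ball ?p0 \<kappa>)" if "\<kappa> > 0" for \<kappa>
  proof -
    have "isCont h 0"
      using h(1) \<eta> by (simp add: continuous_on_eq_continuous_at)
    then obtain \<zeta> where "\<zeta> > 0" "\<And>w. dist w 0 < \<zeta> \<Longrightarrow> dist (h w) (h 0) < \<kappa>"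
      using \<open>\<kappa> > 0\<close> unfolding continuous_at_eps_delta by blast
    then have "h w \<in> ball ?p0 \<kappa>" if "norm w < \<zeta>" for w
      unfolding mem_ball h(2)[symmetric] using that by (metis dist_0_norm dist_commute)
    then have "S \<epsilon> \<subseteq> ball ?p0 \<kappa>" if "0 < \<epsilon>" "\<epsilon> < min \<zeta> \<eta>" for \<epsilon>
      using S[of \<epsilon>] that by (auto simp del: mem_ball)
    then show ?thesis
      using \<open>\<zeta> > 0\<close> \<eta> by (intro exI[of _ "min \<zeta> \<eta>"]) auto
  qed
  have "\<forall>\<^sub>F \<epsilon> in at_right 0. is_isola lam gam c0 c d M I \<epsilon> (S \<epsilon>)"
  proof -
    \<comment> \<open>With radius \<open>\<delta> / 2\<close>, one threshold \<open>\<eta>'\<close>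
      gives confinement at all smaller amplitudes \<open>e \<le> \<epsilon>\<close> as well.\<close>
    obtain \<eta>' where \<eta>': "\<eta>' > 0" "\<eta>' \<le> \<eta>" "\<And>\<epsilon>. 0 < \<epsilon> \<Longrightarrow> \<epsilon> < \<eta>' \<Longrightarrow> S \<epsilon> \<subseteq> ball ?p0 (\<delta> / 2)"
      using small[of "\<delta> / 2"] \<delta>(1) by auto
    have "is_isola lam gam c0 c d M I \<epsilon> (S \<epsilon>)" if \<epsilon>: "0 < \<epsilon>" "\<epsilon> < \<eta>'" for \<epsilon>
    proof -
      \<comment> \<open>The circle of radius \<open>\<epsilon>\<close> lies in the domain of
        \<open>h\<close>, so the branch is a continuous image of the line of phases.\<close>
      have "continuous_on UNIV (\<lambda>\<psi>. h (rcis \<epsilon> \<psi>))"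
        using \<epsilon> \<eta>'(2) unfolding rcis_def
        by (intro continuous_on_compose2[OF h(1)] continuous_intros) (auto simp: norm_mult)
      then have "connected (S \<epsilon>)" "S \<epsilon> \<noteq> {}"
        using S[of \<epsilon>] \<epsilon> \<eta>'(2) by (auto intro: connected_continuous_image)
      moreover have "S e \<subseteq> cball ?p0 (\<delta> / 2)" if "0 < e" "e \<le> \<epsilon>" for e
        using \<eta>'(3)[of e] that \<epsilon> ball_subset_cball by (meson le_less_trans order_trans)
      ultimately show ?thesis
        unfolding S_def using \<epsilon>(1) \<delta> by (intro is_isola_confined) auto
    qed
    then show ?thesis
      using \<eta>'(1) by (auto simp: eventually_at_right_field)
  qed
  moreover have "perturbs_from S ?p0"
    unfolding perturbs_from_def eventually_at_right_field
  proof (intro allI impI)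
    fix \<kappa> :: real assume "\<kappa> > 0"
    from small[OF this] show "\<exists>b>0. \<forall>y>0. y < b \<longrightarrow> S y \<subseteq> ball ?p0 \<kappa>" by auto
  qed
  ultimately show ?thesis
    unfolding \<Omega>0_def by (intro exI[of _ S] conjI)
qed

end
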